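(* For any infinite dimensional complex Banach space $E$ with open unit ball $B_E$, we have $H^\infty(B_E)\subsetneq\mathcal{B}_{inv}(B_E)$.
   Context: $H(B_E)$ is the space of holomorphic (complex Fréchet differentiable) functions $f:B_E\to\mathbb{C}$; $H^\infty(B_E)$ is the space of bounded functions in $H(B_E)$; $Aut(B_E)$ is the set of all biholomorphic bijections $\phi:B_E\to B_E$. For $f\in H(B_E)$ put $\|f\|_{inv}=\sup_{\phi\in Aut(B_E)}\|(f\circ\phi)'(0)\|$ (dual norm of $E^*$). $\mathcal{B}_{inv}(B_E)=\{f\in H(B_E):\|f\|_{inv}<\infty\}$. Known fact (Kaup, Upmeier) recalled by the paper: there is a closed linear subspace $V$ of $E$ such that $\{\phi(0):\phi\in Aut(B_E)\}=B_E\cap V$, and $B_E\cap V$ is a bounded symmetric domain in $V$. *)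

theory Defs
  imports "HOL-Analysis.Analysis"
begin

text \<open>The real structure of a complex normed space is the restriction of its complex structure,
  so that the real Analysis library (topology, Frechet derivatives, completeness) applies.\<close>

class complex_normed_vector = real_normed_vector +
  fixes scaleC :: "complex \<Rightarrow> 'a \<Rightarrow> 'a"  (infixr \<open>*\<^sub>C\<close> 75)
  assumes scaleC_add_right: "a *\<^sub>C (x + y) = a *\<^sub>C x + a *\<^sub>C y"
    and scaleC_add_left: "(a + b) *\<^sub>C x = a *\<^sub>C x + b *\<^sub>C x"
    and scaleC_scaleC: "a *\<^sub>C (b *\<^sub>C x) = (a * b) *\<^sub>C x"
    and scaleR_scaleC: "r *\<^sub>R x = complex_of_real r *\<^sub>C x"
    and norm_scaleC: "norm (a *\<^sub>C x) = cmod a * norm x"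

class complex_banach = complex_normed_vector + banach

global_interpretation complex_vector:
  vector_space "scaleC :: complex \<Rightarrow> 'a \<Rightarrow> 'a :: complex_normed_vector"
  defines cspan = complex_vector.span
proof
  fix x :: 'a
  show "1 *\<^sub>C x = x"
    using scaleR_scaleC[of 1 x] by simp
qed (simp_all add: scaleC_add_right scaleC_add_left scaleC_scaleC)

instantiation complex :: complex_banach
begin

definition scaleC_complex :: "complex \<Rightarrow> complex \<Rightarrow> complex"
  where "scaleC_complex a x = a * x"

instance
  by standard
    (simp_all add: scaleC_complex_def algebra_simps scaleR_conv_of_real norm_mult)

end

abbreviation unit_ball :: "'a :: complex_normed_vector set"
  where "unit_ball \<equiv> ball 0 1"

text \<open>Functions on a subset are represented by total functions. For open \<open>S\<close>, whether \<open>f\<close> is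
  holomorphic on \<open>S\<close> depends only on the values of \<open>f\<close> on \<open>S\<close>. Boundedness of the
  derivative is part of \<^const>\<open>has_derivative\<close>.\<close>

definition frechet_holomorphic_on ::
    "('a :: complex_normed_vector \<Rightarrow> 'b :: complex_normed_vector) \<Rightarrow> 'a set \<Rightarrow> bool"
    (infixl \<open>frechet'_holomorphic'_on\<close> 50)
  where "f frechet_holomorphic_on S \<longleftrightarrow>
    (\<forall>x\<in>S. \<exists>D. Vector_Spaces.linear scaleC scaleC D \<and> (f has_derivative D) (at x))"

definition H_infty :: "('a :: complex_normed_vector \<Rightarrow> complex) set"
  where "H_infty = {f. f frechet_holomorphic_on unit_ball \<and> bounded (f ` unit_ball)}"

definition Aut_ball :: "('a :: complex_normed_vector \<Rightarrow> 'a) set"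
  where "Aut_ball = {\<phi>. bij_betw \<phi> unit_ball unit_ball \<and>
    \<phi> frechet_holomorphic_on unit_ball \<and>
    inv_into unit_ball \<phi> frechet_holomorphic_on unit_ball}"

definition inv_norm :: "('a :: complex_normed_vector \<Rightarrow> complex) \<Rightarrow> ennreal"
  where "inv_norm f = (SUP \<phi>\<in>Aut_ball. ennreal (onorm (frechet_derivative (f \<circ> \<phi>) (at 0))))"

definition B_inv :: "('a :: complex_normed_vector \<Rightarrow> complex) set"
  where "B_inv = {f. f frechet_holomorphic_on unit_ball \<and> inv_norm f < \<infinity>}"

end

theory Submission
  imports Defs "HOL-Complex_Analysis.Cauchy_Integral_Formula"
begin

text \<open>If \<open>f\<close> is bounded and holomorphic on the unit ball, then so is \<open>f \<circ> \<phi>\<close>, with the same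
  bound, and Cauchy's inequality on complex lines through the origin bounds its derivative at \<open>0\<close>.
  For strictness, take by Hahn-Banach a functional \<open>l\<close> of norm one with \<open>l x = 1\<close> for some unit
  vector \<open>x\<close>, and let \<open>f = Ln (1 - l)\<close>. It is unbounded along \<open>r x\<close> as \<open>r\<close> tends to \<open>1\<close>, but its
  imaginary part is at most \<open>\<pi> / 2\<close> in modulus, so \<open>g = exp (\<i> f)\<close> is bounded and bounded away
  from \<open>0\<close>. As \<open>(f \<circ> \<phi>)' = (g \<circ> \<phi>)' / (\<i> (g \<circ> \<phi>))\<close>, the invariant seminorm of \<open>f\<close> is finite
  because that of \<open>g\<close> is.\<close>

section \<open>The Hahn-Banach theorem\<close>

definition sublinear :: "('a::real_vector \<Rightarrow> real) \<Rightarrow> bool"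
  where "sublinear p \<longleftrightarrow>
    (\<forall>x y. p (x + y) \<le> p x + p y) \<and> (\<forall>c x. 0 \<le> c \<longrightarrow> p (c *\<^sub>R x) = c * p x)"

lemma sublinear_add: "sublinear p \<Longrightarrow> p (x + y) \<le> p x + p y"
  and sublinear_scaleR: "sublinear p \<Longrightarrow> 0 \<le> c \<Longrightarrow> p (c *\<^sub>R x) = c * p x"
  by (auto simp: sublinear_def)

lemma sublinear_0: "sublinear p \<Longrightarrow> p 0 = 0"
  using sublinear_scaleR[of p 0 0] by simp

lemma sublinear_minus: "sublinear p \<Longrightarrow> - p (- x) \<le> p x"
  using sublinear_add[of p x "- x"] sublinear_0[of p] by simp

text \<open>One inequality for positive factors suffices: applied to \<open>inverse c\<close> and
  the vector \<open>c *\<^sub>R x\<close>, it yields the reverse inequality.\<close>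

lemma sublinearI:
  assumes add: "\<And>x y. p (x + y) \<le> p x + p y"
    and scale: "\<And>c x. 0 < c \<Longrightarrow> p (c *\<^sub>R x) \<le> c * p x"
  shows "sublinear p"
proof -
  have "p (c *\<^sub>R x) = c * p x" if "0 \<le> c" for c x
  proof (cases "c = 0")
    case True
    \<comment> \<open>The factor 1/2 gives the upper bound and the factor 2 the lower one.\<close>
    have "p 0 \<le> 0" "0 \<le> p 0"
      using scale[of "1/2" 0] scale[of 2 0] by simp_all
    then show ?thesis using True by simp
  next
    case False
    then have c: "0 < c" using that by simp
    have "p x \<le> inverse c * p (c *\<^sub>R x)"
      using scale[of "inverse c" "c *\<^sub>R x"] c by simp
    then have "c * p x \<le> p (c *\<^sub>R x)"
      using c by (simp add: field_simps)
    then show ?thesis using scale[OF c, of x] by simp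
  qed
  then show ?thesis using add by (simp add: sublinear_def)
qed

lemma sublinear_norm: "sublinear (norm :: 'a::real_normed_vector \<Rightarrow> real)"
  by (rule sublinearI) (auto simp: norm_triangle_ineq)

text \<open>Supplies the lower bounds for Zorn's lemma. The infimum is finite because every
  \<open>p\<close> in \<open>C\<close> satisfies \<open>- q (- y) \<le> - p (- y) \<le> p y\<close>.
  Subadditivity uses the chain: two members can be replaced by the smaller one.\<close>

lemma sublinear_INF_chain:
  assumes "C \<noteq> {}"
    and sub: "\<And>p. p \<in> C \<Longrightarrow> sublinear p \<and> p \<le> q"
    and chain: "\<And>p p'. p \<in> C \<Longrightarrow> p' \<in> C \<Longrightarrow> p \<le> p' \<or> p' \<le> p"
  shows "sublinear (\<lambda>x. INF p\<in>C. p x)"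
    and "p \<in> C \<Longrightarrow> (INF p\<in>C. p x) \<le> p x"
proof -
  have "- q (- y) \<le> p y" if "p \<in> C" for p y
    using sublinear_minus[of p y] sub[OF that] by (auto simp: le_fun_def intro: order_trans[rotated])
  then have bdd: "bdd_below ((\<lambda>p. p y) ` C)" for y
    by (intro bdd_belowI[of _ "- q (- y)"]) auto
  show low: "(INF p\<in>C. p y) \<le> p y" if "p \<in> C" for p y
    using cINF_lower[OF bdd that] .
  show "sublinear (\<lambda>x. INF p\<in>C. p x)"
  proof (rule sublinearI)
    fix x y
    have *: "(INF p\<in>C. p (x + y)) \<le> p1 x + p2 y" if p12: "p1 \<in> C" "p2 \<in> C" for p1 p2
    proof -
      obtain p where p: "p \<in> C" "p \<le> p1" "p \<le> p2"
        using chain[OF p12] p12 by blast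
      have "(INF p\<in>C. p (x + y)) \<le> p (x + y)" using low[OF p(1)] .
      also have "\<dots> \<le> p x + p y" using sub[OF p(1)] by (simp add: sublinear_add)
      also have "\<dots> \<le> p1 x + p2 y" using p by (simp add: add_mono le_funD)
      finally show ?thesis .
    qed
    have "(INF p\<in>C. p (x + y)) - p2 y \<le> (INF p\<in>C. p x)" if "p2 \<in> C" for p2
      using *[OF _ that] \<open>C \<noteq> {}\<close> by (intro cINF_greatest) (auto simp: algebra_simps)
    then have "(INF p\<in>C. p (x + y)) - (INF p\<in>C. p x) \<le> (INF p\<in>C. p y)"
      using \<open>C \<noteq> {}\<close> by (intro cINF_greatest) (auto simp: algebra_simps)
    then show "(INF p\<in>C. p (x + y)) \<le> (INF p\<in>C. p x) + (INF p\<in>C. p y)" by simp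
  next
    fix c :: real and x assume c: "0 < c"
    have "(INF p\<in>C. p (c *\<^sub>R x)) / c \<le> (INF p\<in>C. p x)"
    proof (rule cINF_greatest[OF \<open>C \<noteq> {}\<close>])
      fix p assume p: "p \<in> C"
      have "(INF p\<in>C. p (c *\<^sub>R x)) \<le> c * p x"
        using low[OF p, of "c *\<^sub>R x"] sub[OF p] c by (simp add: sublinear_scaleR)
      then show "(INF p\<in>C. p (c *\<^sub>R x)) / c \<le> p x" using c by (simp add: field_simps)
    qed
    then show "(INF p\<in>C. p (c *\<^sub>R x)) \<le> c * (INF p\<in>C. p x)"
      using c by (simp add: field_simps)
  qed
qed

text \<open>The usual device for making \<open>p\<close> linear along \<open>y\<close>: at
  \<open>- y\<close>, the parameter \<open>t = 1\<close> bounds the value by \<open>- p y\<close>,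
  as linearity would demand.\<close>

definition sublinear_shift :: "('a::real_vector \<Rightarrow> real) \<Rightarrow> 'a \<Rightarrow> 'a \<Rightarrow> real"
  where "sublinear_shift p y x = (INF t\<in>{0..}. p (x + t *\<^sub>R y) - t * p y)"

text \<open>By subadditivity \<open>- p (- x)\<close> bounds all the terms from below, so the
  infimum is a genuine one.\<close>

lemma sublinear_shift_le:
  assumes "sublinear p" "0 \<le> t"
  shows "sublinear_shift p y x \<le> p (x + t *\<^sub>R y) - t * p y"
proof -
  have "- p (- x) \<le> p (x + t *\<^sub>R y) - t * p y" if "0 \<le> t" for t
    using sublinear_add[OF assms(1), of "x + t *\<^sub>R y" "- x"] sublinear_scaleR[OF assms(1) that, of y]
    by simp
  then show ?thesis
    unfolding sublinear_shift_def using assms(2)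
    by (intro cINF_lower bdd_belowI[of _ "- p (- x)"]) auto
qed

lemma sublinear_shift_le_self: "sublinear p \<Longrightarrow> sublinear_shift p y x \<le> p x"
  using sublinear_shift_le[of p 0 y x] by simp

text \<open>Parameters \<open>t\<close> for \<open>u\<close> and \<open>s\<close> for
  \<open>v\<close> combine to \<open>t + s\<close> for \<open>u + v\<close>; scaling by
  \<open>c\<close> replaces \<open>t\<close> by \<open>c * t\<close>.\<close>

lemma sublinear_sublinear_shift:
  assumes p: "sublinear p"
  shows "sublinear (sublinear_shift p y)"
proof (rule sublinearI)
  fix u v
  let ?s = "sublinear_shift p y"
  have *: "?s (u + v) \<le> (p (u + t *\<^sub>R y) - t * p y) + (p (v + s *\<^sub>R y) - s * p y)"
    if "0 \<le> t" "0 \<le> s" for t s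
    using sublinear_shift_le[OF p, of "t + s" y "u + v"] that
      sublinear_add[OF p, of "u + t *\<^sub>R y" "v + s *\<^sub>R y"]
    by (simp add: algebra_simps)
  have "?s (u + v) - (p (v + s *\<^sub>R y) - s * p y) \<le> ?s u" if "0 \<le> s" for s
    unfolding sublinear_shift_def[of p y u]
    by (rule cINF_greatest) (use *[OF _ that] in \<open>auto simp: algebra_simps\<close>)
  then have "?s (u + v) - ?s u \<le> ?s v"
    unfolding sublinear_shift_def[of p y v]
    by (intro cINF_greatest) (auto simp: algebra_simps)
  then show "?s (u + v) \<le> ?s u + ?s v" by simp
next
  fix c :: real and x assume c: "0 < c"
  let ?s = "sublinear_shift p y"
  have "?s (c *\<^sub>R x) / c \<le> ?s x"
    unfolding sublinear_shift_def[of p y x]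
  proof (rule cINF_greatest)
    fix t :: real assume "t \<in> {0..}"
    then have "?s (c *\<^sub>R x) \<le> p (c *\<^sub>R (x + t *\<^sub>R y)) - (c * t) * p y"
      using sublinear_shift_le[OF p, of "c * t" y "c *\<^sub>R x"] c by (simp add: algebra_simps)
    also have "\<dots> = c * (p (x + t *\<^sub>R y) - t * p y)"
      using sublinear_scaleR[OF p, of c "x + t *\<^sub>R y"] c by (simp add: algebra_simps)
    finally show "?s (c *\<^sub>R x) / c \<le> p (x + t *\<^sub>R y) - t * p y"
      using c by (simp add: field_simps)
  qed simp
  then show "?s (c *\<^sub>R x) \<le> c * ?s x" using c by (simp add: field_simps)
qed

text \<open>A minimal sublinear functional \<open>p\<close> equals all of its shifts, which makes it superadditive.\<close>

theorem Hahn_Banach_dominated: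
  fixes q :: "'a::real_vector \<Rightarrow> real"
  assumes q: "sublinear q"
  shows "\<exists>f. linear f \<and> (\<forall>x. f x \<le> q x)"
proof -
  define A where "A = {p. sublinear p \<and> p \<le> q}"
  have "\<exists>p\<in>A. \<forall>p'\<in>A. p' \<le> p \<longrightarrow> p' = p"
  proof (rule predicate_Zorn)
    \<comment> \<open>The order is reversed, so that the maximal element from Zorn's lemma is a
      minimal sublinear functional.\<close>
    show "partial_order_on A (relation_of (\<lambda>p p'. p' \<le> p) A)"
      by (rule partial_order_on_relation_ofI) auto
  next
    fix C assume "C \<in> Chains (relation_of (\<lambda>p p'. p' \<le> p) A)"
    then have C: "C \<subseteq> A" "\<And>p p'. p \<in> C \<Longrightarrow> p' \<in> C \<Longrightarrow> p \<le> p' \<or> p' \<le> p"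
      by (auto simp: Chains_def relation_of_def)
    show "\<exists>u\<in>A. \<forall>p\<in>C. u \<le> p"
    proof (cases "C = {}")
      case True
      then show ?thesis using q by (auto simp: A_def)
    next
      case False
      have sub: "\<And>p. p \<in> C \<Longrightarrow> sublinear p \<and> p \<le> q" using C(1) by (auto simp: A_def)
      let ?u = "\<lambda>x. INF p\<in>C. p x"
      have le: "?u \<le> p" if "p \<in> C" for p
        using sublinear_INF_chain(2)[OF False sub C(2) that] by (simp add: le_fun_def)
      obtain p where "p \<in> C" using False by blast
      then have "?u \<le> q" using le sub order_trans by blast
      then have "?u \<in> A" using sublinear_INF_chain(1)[OF False sub C(2)] by (simp add: A_def)
      then show ?thesis using le by blast
    qed
  qed
  then obtain p where p: "sublinear p" "p \<le> q" and min: "\<And>p'. p' \<in> A \<Longrightarrow> p' \<le> p \<Longrightarrow> p' = p"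
    by (auto simp: A_def)
  have "sublinear_shift p y = p" for y
  proof (rule min)
    show le: "sublinear_shift p y \<le> p"
      by (simp add: le_fun_def sublinear_shift_le_self p(1))
    show "sublinear_shift p y \<in> A"
      using order_trans[OF le p(2)] by (simp add: A_def sublinear_sublinear_shift p(1))
  qed
  \<comment> \<open>Superadditivity, from the parameter \<open>t = 1\<close> in the shift.\<close>
  then have "p x \<le> p (x + y) - p y" for x y
    using sublinear_shift_le[OF p(1), of 1 y x] by simp
  then have add: "p (x + y) = p x + p y" for x y
    using sublinear_add[OF p(1), of x y] by (smt (verit))
  have neg: "p (- x) = - p x" for x
    using add[of x "- x"] sublinear_0[OF p(1)] by simp
  have "p (c *\<^sub>R x) = c * p x" for c x
    using sublinear_scaleR[OF p(1), of c x] sublinear_scaleR[OF p(1), of "- c" x] neg[of "c *\<^sub>R x"]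
    by (cases "0 \<le> c") auto
  then have "linear p" using add by (intro linearI) auto
  then show ?thesis using p(2) by (auto simp: le_fun_def)
qed

section \<open>Norming functionals, real and complex\<close>

lemma real_norming_functional:
  fixes x :: "'a::real_normed_vector"
  shows "\<exists>f. linear f \<and> (\<forall>y. f y \<le> norm y) \<and> f x = norm x"
proof -
  \<comment> \<open>Domination by the shift of the norm along \<open>x\<close>, rather than by the
    norm itself, forces \<open>f (- x) \<le> - norm x\<close>, hence equality at
    \<open>x\<close>.\<close>
  obtain f where f: "linear f" "\<And>y. f y \<le> sublinear_shift norm x y"
    using Hahn_Banach_dominated[OF sublinear_sublinear_shift[OF sublinear_norm]] by metis
  have le: "f y \<le> norm y" for y
    using order_trans[OF f(2) sublinear_shift_le_self[OF sublinear_norm]] .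
  have "f (- x) \<le> - norm x"
    using order_trans[OF f(2)[of "- x"] sublinear_shift_le[OF sublinear_norm, of 1 x "- x"]] by simp
  then have "f x = norm x" using le[of x] linear_neg[OF f(1), of x] by simp
  then show ?thesis using f(1) le by blast
qed

lemma complex_norming_functional:
  fixes x :: "'a::complex_normed_vector"
  shows "\<exists>l. Vector_Spaces.linear scaleC scaleC l \<and> (\<forall>y. cmod (l y) \<le> norm y) \<and> l x = norm x"
proof -
  obtain f where f: "linear f" and le: "\<And>y. f y \<le> norm y" and fx: "f x = norm x"
    using real_norming_functional[of x] by blast
  \<comment> \<open>The complex linear functional with real part \<open>f\<close>, namely
    \<open>f y - \<i> * f (\<i> *\<^sub>C y)\<close>.\<close>
  define l where "l y = Complex (f y) (- f (\<i> *\<^sub>C y))" for y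
  have l_add: "l (y + z) = l y + l z" for y z
    by (simp add: l_def scaleC_add_right linear_add[OF f] complex_eq_iff)
  have decomp: "c *\<^sub>C y = Re c *\<^sub>R y + Im c *\<^sub>R (\<i> *\<^sub>C y)" for c and y :: 'a
  proof -
    have "Re c *\<^sub>R y + Im c *\<^sub>R (\<i> *\<^sub>C y) = (of_real (Re c) + of_real (Im c) * \<i>) *\<^sub>C y"
      by (simp add: scaleR_scaleC scaleC_add_left scaleC_scaleC)
    also have "of_real (Re c) + of_real (Im c) * \<i> = c" by (simp add: complex_eq_iff)
    finally show ?thesis by simp
  qed
  have l_scale: "l (c *\<^sub>C y) = c * l y" for c y
  proof -
    have 1: "f (c *\<^sub>C y) = Re c * f y + Im c * f (\<i> *\<^sub>C y)" for c y
      by (subst decomp[of c y]) (simp only: linear_add[OF f] linear_scale[OF f] real_scaleR_def)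
    have "f (\<i> *\<^sub>C (c *\<^sub>C y)) = - Im c * f y + Re c * f (\<i> *\<^sub>C y)"
      using 1[of "\<i> * c" y] by (simp add: scaleC_scaleC)
    then show ?thesis using 1[of c y] by (simp add: l_def complex_eq_iff)
  qed
  have "Vector_Spaces.linear scaleC scaleC l"
    by unfold_locales (simp_all add: l_add l_scale scaleC_complex_def algebra_simps)
  moreover have bd: "cmod (l y) \<le> norm y" for y
  proof (cases "l y = 0")
    case False
    \<comment> \<open>Rotating \<open>y\<close> by the unimodular \<open>c\<close> makes the value
      of \<open>l\<close> real and nonnegative, so that the bound on its real part \<open>f\<close>
      bounds its modulus.\<close>
    define c where "c = cnj (sgn (l y))"
    have "c * l y = of_real (cmod (l y))"
      using False by (simp add: c_def sgn_eq complex_norm_square[symmetric] power2_eq_square field_simps)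
    then have "cmod (l y) = Re (l (c *\<^sub>C y))" by (simp add: l_scale)
    also have "\<dots> \<le> norm (c *\<^sub>C y)" by (simp add: l_def le)
    also have "\<dots> = norm y" using False by (simp add: norm_scaleC c_def norm_sgn)
    finally show ?thesis .
  qed simp
  moreover have "l x = norm x"
  proof -
    \<comment> \<open>The real part already exhausts the bound on the modulus, so the imaginary part
      vanishes.\<close>
    have "Re (l x) = norm x" by (simp add: l_def fx)
    moreover have "(Re (l x))\<^sup>2 + (Im (l x))\<^sup>2 \<le> (norm x)\<^sup>2"
      using power_mono[OF bd[of x], of 2] by (simp add: cmod_power2)
    ultimately show ?thesis by (simp add: complex_eq_iff)
  qed
  ultimately show ?thesis by blast
qed

section \<open>The invariant seminorm\<close>

lemma bounded_linear_scaleC_left: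
  "bounded_linear (\<lambda>c. c *\<^sub>C (x :: 'a::complex_normed_vector))"
proof (rule bounded_linear_intro[where K = "norm x"])
  show "(r *\<^sub>R c) *\<^sub>C x = r *\<^sub>R (c *\<^sub>C x)" for r c
    by (simp only: scaleR_scaleC[of _ "_ :: 'a"] scaleC_scaleC scaleR_conv_of_real)
qed (simp_all add: scaleC_add_left norm_scaleC)

lemma linear_scaleC_complex:
  fixes D :: "'a::complex_normed_vector \<Rightarrow> complex"
  shows "Vector_Spaces.linear scaleC scaleC D \<Longrightarrow> D (c *\<^sub>C x) = c * D x"
  using vector_space_pair.linear_scale[of scaleC scaleC D c x]
  by (simp add: vector_space_pair_def complex_vector.vector_space_axioms scaleC_complex_def)

lemma frechet_holomorphic_on_compose:
  assumes "f frechet_holomorphic_on T" "g frechet_holomorphic_on S" "g ` S \<subseteq> T"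
  shows "(f \<circ> g) frechet_holomorphic_on S"
  unfolding frechet_holomorphic_on_def
proof
  fix x assume x: "x \<in> S"
  obtain D where D: "Vector_Spaces.linear scaleC scaleC D" "(g has_derivative D) (at x)"
    using assms(2) x unfolding frechet_holomorphic_on_def by blast
  obtain D' where D': "Vector_Spaces.linear scaleC scaleC D'" "(f has_derivative D') (at (g x))"
    using assms(1,3) x unfolding frechet_holomorphic_on_def by blast
  show "\<exists>D. Vector_Spaces.linear scaleC scaleC D \<and> (f \<circ> g has_derivative D) (at x)"
    using Vector_Spaces.linear_compose[OF D(1) D'(1)] diff_chain_at[OF D(2) D'(2)] by blast
qed

text \<open>Multiplication by a complex number is complex linear, so a scalar derivative is a
  Frechet one. This allows composing with \<open>exp\<close> and \<open>Ln\<close>.\<close>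

lemma frechet_holomorphic_on_DERIV_compose:
  fixes h :: "complex \<Rightarrow> complex"
  assumes f: "f frechet_holomorphic_on S"
    and h: "\<And>x. x \<in> S \<Longrightarrow> (h has_field_derivative h' (f x)) (at (f x))"
  shows "(\<lambda>x. h (f x)) frechet_holomorphic_on S"
proof -
  have "Vector_Spaces.linear scaleC scaleC ((*) (c :: complex))" for c
    by unfold_locales (simp_all add: scaleC_complex_def algebra_simps)
  then have "h frechet_holomorphic_on f ` S"
    using h unfolding frechet_holomorphic_on_def has_field_derivative_def by blast
  from frechet_holomorphic_on_compose[OF this f] show ?thesis by (simp add: comp_def)
qed

text \<open>The one-variable inequality is applied to \<open>f\<close> on the complex line through
  the unit vector \<open>u\<close> in the direction of \<open>v\<close>. The factor 2 comes from the
  circle of radius 1/2, whose closed disc lies inside the domain; a sharper constant would not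
  affect finiteness of the seminorm.\<close>

lemma frechet_Cauchy_inequality:
  fixes f :: "'a::complex_normed_vector \<Rightarrow> complex"
  assumes f: "f frechet_holomorphic_on unit_ball"
    and bd: "\<And>x. x \<in> unit_ball \<Longrightarrow> cmod (f x) \<le> M"
    and D: "(f has_derivative D) (at 0)"
  shows "cmod (D v) \<le> 2 * M * norm v"
proof (cases "v = 0")
  case True
  then show ?thesis using has_derivative_bounded_linear[OF D] by (simp add: linear_simps)
next
  case False
  define u where "u = (1 / norm v) *\<^sub>R v"
  have u: "norm u = 1" using False by (simp add: u_def)
  have ball: "z *\<^sub>C u \<in> unit_ball" if "cmod z < 1" for z
    using that u by (simp add: norm_scaleC)
  define g where "g z = f (z *\<^sub>C u)" for z
  have deriv: "(g has_field_derivative D' u) (at z)"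
    if "(f has_derivative D') (at (z *\<^sub>C u))" "Vector_Spaces.linear scaleC scaleC D'" for z D'
  proof -
    have "((\<lambda>z. f (z *\<^sub>C u)) has_derivative (\<lambda>w. D' (w *\<^sub>C u))) (at z)"
      using has_derivative_compose[OF bounded_linear.has_derivative[OF bounded_linear_scaleC_left
            has_derivative_ident] that(1)] .
    then show ?thesis
      unfolding g_def has_field_derivative_def
      by (simp only: linear_scaleC_complex[OF that(2)] mult_commute_abs)
  qed
  have "g field_differentiable (at z)" if "cmod z < 1" for z
    using f ball[OF that] deriv unfolding frechet_holomorphic_on_def field_differentiable_def by blast
  then have hol: "g holomorphic_on ball 0 1"
    by (auto simp: holomorphic_on_def intro: field_differentiable_at_within)
  have "cmod ((deriv ^^ 1) g 0) \<le> fact 1 * M / (1/2) ^ 1"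
  proof (rule Cauchy_inequality)
    show "g holomorphic_on ball 0 (1/2)"
      using hol by (rule holomorphic_on_subset) auto
    show "continuous_on (cball 0 (1/2)) g"
      using hol by (intro holomorphic_on_imp_continuous_on) (auto elim!: holomorphic_on_subset)
    show "cmod (g z) \<le> M" if "cmod (0 - z) = 1/2" for z
      using that ball bd by (simp add: g_def)
  qed simp
  moreover have "deriv g 0 = D u"
  proof -
    \<comment> \<open>\<open>D\<close> is given only as a real derivative; uniqueness identifies it
      with the complex linear one.\<close>
    obtain D' where D': "Vector_Spaces.linear scaleC scaleC D'" "(f has_derivative D') (at 0)"
      using f unfolding frechet_holomorphic_on_def by fastforce
    then have "D' = D" using D has_derivative_unique by blast
    then show ?thesis using D' deriv[of D 0] by (auto intro: DERIV_imp_deriv)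
  qed
  ultimately have "cmod (D u) \<le> 2 * M" by simp
  moreover have "D v = norm v *\<^sub>R D u"
    using has_derivative_bounded_linear[OF D] False by (simp add: u_def linear_simps)
  ultimately show ?thesis using False by (simp add: mult.commute mult_left_mono)
qed

section \<open>Derivative bounds uniform over the automorphisms\<close>

lemma Aut_ball_0: "\<phi> \<in> Aut_ball \<Longrightarrow> \<phi> 0 \<in> unit_ball"
  using bij_betwE[of \<phi> unit_ball unit_ball] by (force simp: Aut_ball_def)

lemma has_derivative_Aut_ball:
  assumes "f frechet_holomorphic_on unit_ball" "\<phi> \<in> Aut_ball"
  shows "(f \<circ> \<phi> has_derivative frechet_derivative (f \<circ> \<phi>) (at 0)) (at 0)"
    and "(f \<circ> \<phi>) frechet_holomorphic_on unit_ball"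
proof -
  show *: "(f \<circ> \<phi>) frechet_holomorphic_on unit_ball"
    using assms by (intro frechet_holomorphic_on_compose[of f unit_ball])
      (auto simp: Aut_ball_def bij_betw_def)
  show "(f \<circ> \<phi> has_derivative frechet_derivative (f \<circ> \<phi>) (at 0)) (at 0)"
    using * unfolding frechet_holomorphic_on_def
    by (metis centre_in_ball differentiable_def frechet_derivative_works zero_less_one)
qed

lemma B_invI:
  fixes f :: "'a::complex_normed_vector \<Rightarrow> complex"
  assumes "f frechet_holomorphic_on unit_ball"
    and "\<And>\<phi> v. \<phi> \<in> Aut_ball \<Longrightarrow> cmod (frechet_derivative (f \<circ> \<phi>) (at 0) v) \<le> C * norm v"
  shows "f \<in> B_inv"
proof -
  \<comment> \<open>The sign of \<open>C\<close> is not prescribed, while a bound for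
    \<open>onorm\<close> must be nonnegative; hence the absolute value.\<close>
  have "inv_norm f \<le> ennreal \<bar>C\<bar>"
    unfolding inv_norm_def
  proof (intro SUP_least ennreal_leI onorm_bound)
    fix \<phi> :: "'a \<Rightarrow> 'a" and v assume "\<phi> \<in> Aut_ball"
    then have "cmod (frechet_derivative (f \<circ> \<phi>) (at 0) v) \<le> C * norm v"
      by (rule assms(2))
    also have "\<dots> \<le> \<bar>C\<bar> * norm v" by (intro mult_right_mono) auto
    finally show "cmod (frechet_derivative (f \<circ> \<phi>) (at 0) v) \<le> \<bar>C\<bar> * norm v" .
  qed simp
  also have "\<dots> < \<infinity>" by simp
  finally show ?thesis using assms(1) by (simp add: B_inv_def)
qed

text \<open>Since \<phi> maps the ball to itself, \<open>g \<circ> \<phi>\<close> inherits the bound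
  \<open>M\<close>, and the constant does not depend on \<phi>.\<close>

lemma bounded_imp_derivative_Aut_ball_le:
  assumes "g frechet_holomorphic_on unit_ball"
    and "\<And>x. x \<in> unit_ball \<Longrightarrow> cmod (g x) \<le> M"
    and "\<phi> \<in> Aut_ball"
  shows "cmod (frechet_derivative (g \<circ> \<phi>) (at 0) v) \<le> 2 * M * norm v"
proof (rule frechet_Cauchy_inequality[OF has_derivative_Aut_ball(2)[OF assms(1,3)] _ has_derivative_Aut_ball(1)[OF assms(1,3)]])
  show "cmod ((g \<circ> \<phi>) x) \<le> M" if "x \<in> unit_ball" for x
    using that assms(2,3) bij_betwE[of \<phi> unit_ball unit_ball] unfolding Aut_ball_def by auto
qed

lemma H_infty_subset_B_inv: "H_infty \<subseteq> B_inv"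
proof
  fix f :: "'a \<Rightarrow> complex" assume "f \<in> H_infty"
  then obtain M where "f frechet_holomorphic_on unit_ball" "\<And>x. x \<in> unit_ball \<Longrightarrow> cmod (f x) \<le> M"
    unfolding H_infty_def bounded_iff by blast
  then show "f \<in> B_inv"
    by (blast intro: B_invI bounded_imp_derivative_Aut_ball_le)
qed

text \<open>The modulus of \<open>exp (\<i> * z)\<close> is \<open>exp (- Im z)\<close>, so that of
  \<open>g\<close> lies between \<open>exp (- B)\<close> and \<open>exp B\<close>. The upper bound
  controls the derivative of \<open>g \<circ> \<phi>\<close>; the lower one lets the factor
  \<open>w\<close> be divided out, at the cost of another \<open>exp B\<close>.\<close>

lemma bounded_Im_imp_B_inv:
  assumes f: "f frechet_holomorphic_on unit_ball"
    and Im: "\<And>x. x \<in> unit_ball \<Longrightarrow> \<bar>Im (f x)\<bar> \<le> B"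
  shows "f \<in> B_inv"
proof (rule B_invI[OF f])
  fix \<phi> :: "'a \<Rightarrow> 'a" and v assume \<phi>: "\<phi> \<in> Aut_ball"
  define g where "g x = exp (\<i> * f x)" for x
  have g_hol: "g frechet_holomorphic_on unit_ball"
    unfolding g_def
    by (rule frechet_holomorphic_on_DERIV_compose[OF f, of _ "\<lambda>z. exp (\<i> * z) * \<i>"])
      (auto intro!: derivative_eq_intros)
  have g_bd: "cmod (g x) \<le> exp B" if "x \<in> unit_ball" for x
    using Im[OF that] by (simp add: g_def norm_exp_eq_Re)
  define D where "D = frechet_derivative (f \<circ> \<phi>) (at 0)"
  define w where "w = exp (\<i> * f (\<phi> 0))"
  have D: "(f \<circ> \<phi> has_derivative D) (at 0)"
    unfolding D_def using has_derivative_Aut_ball(1)[OF f \<phi>] .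
  have "((\<lambda>z. exp (\<i> * z)) has_derivative (*) (w * \<i>)) (at ((f \<circ> \<phi>) 0))"
    unfolding has_field_derivative_def[symmetric] w_def
    by (auto intro!: derivative_eq_intros)
  from diff_chain_at[OF D this]
  have "(g \<circ> \<phi> has_derivative (\<lambda>v. w * \<i> * D v)) (at 0)"
    by (simp add: g_def comp_def)
  then have "frechet_derivative (g \<circ> \<phi>) (at 0) = (\<lambda>v. w * \<i> * D v)"
    using frechet_derivative_at by metis
  then have "cmod w * cmod (D v) \<le> 2 * exp B * norm v"
    using bounded_imp_derivative_Aut_ball_le[OF g_hol g_bd \<phi>, of v] by (simp add: norm_mult)
  moreover have "exp (- B) \<le> cmod w"
    using Im[OF Aut_ball_0[OF \<phi>]] by (simp add: w_def norm_exp_eq_Re)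
  then have "exp (- B) * cmod (D v) \<le> cmod w * cmod (D v)"
    by (rule mult_right_mono) simp
  ultimately have "exp (- B) * cmod (D v) \<le> 2 * exp B * norm v" by linarith
  then show "cmod (D v) \<le> (2 * exp B * exp B) * norm v"
    by (simp add: exp_minus field_simps)
qed

section \<open>Strictness: an unbounded logarithm\<close>

lemma B_inv_not_subset_H_infty:
  fixes x :: "'a::complex_normed_vector"
  assumes "x \<noteq> 0"
  shows "\<exists>f :: 'a \<Rightarrow> complex. f \<in> B_inv \<and> f \<notin> H_infty"
proof -
  define u where "u = (1 / norm x) *\<^sub>R x"
  have u: "norm u = 1" using assms by (simp add: u_def)
  obtain l where l: "Vector_Spaces.linear scaleC scaleC l" "\<And>y. cmod (l y) \<le> norm y" "l u = 1"
    using complex_norming_functional[of u] u by auto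
  have l_scale: "l (c *\<^sub>C y) = c * l y" for c y using linear_scaleC_complex[OF l(1)] .
  have "bounded_linear l"
  proof (rule bounded_linear_intro[where K = 1])
    show "l (y + z) = l y + l z" for y z
      using vector_space_pair.linear_add[OF _ l(1)]
      by (simp add: vector_space_pair_def complex_vector.vector_space_axioms)
  qed (simp_all add: l scaleR_scaleC l_scale scaleC_complex_def)
  then have l_hol: "l frechet_holomorphic_on unit_ball"
    unfolding frechet_holomorphic_on_def using l(1) bounded_linear_imp_has_derivative by blast
  \<comment> \<open>On the right half plane the principal logarithm is holomorphic and its imaginary
    part is less than \<open>pi / 2\<close> in modulus.\<close>
  have Re_pos: "0 < Re (1 - l y)" if "y \<in> unit_ball" for y
    using that l(2)[of y] complex_Re_le_cmod[of "l y"] by simp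
  define f where "f y = Ln (1 - l y)" for y
  have "f frechet_holomorphic_on unit_ball"
    unfolding f_def
  proof (rule frechet_holomorphic_on_DERIV_compose[OF l_hol, of "\<lambda>z. Ln (1 - z)" "\<lambda>z. - 1 / (1 - z)"])
    fix y :: 'a assume "y \<in> unit_ball"
    then have "1 - l y \<notin> \<real>\<^sub>\<le>\<^sub>0" using Re_pos[of y] by (auto simp: complex_nonpos_Reals_iff)
    then show "((\<lambda>z. Ln (1 - z)) has_field_derivative - 1 / (1 - l y)) (at (l y))"
      by (auto intro!: derivative_eq_intros simp: field_simps)
  qed
  moreover have "\<bar>Im (f y)\<bar> \<le> pi / 2" if "y \<in> unit_ball" for y
    using Re_pos[OF that] Re_Ln_pos_lt_imp[of "1 - l y"] by (force simp: f_def)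
  ultimately have "f \<in> B_inv" by (rule bounded_Im_imp_B_inv)
  moreover have "f \<notin> H_infty"
  proof
    assume "f \<in> H_infty"
    then obtain M where M: "\<And>y. y \<in> unit_ball \<Longrightarrow> cmod (f y) \<le> M"
      unfolding H_infty_def bounded_iff by blast
    \<comment> \<open>As \<open>l u = 1\<close>, the value of \<open>f\<close> at
      \<open>(1 - s) *\<^sub>R u\<close> is \<open>Ln s\<close>; this \<open>s\<close> gives it
      modulus \<open>\<bar>M\<bar> + 1\<close>, beyond the bound \<open>M\<close>.\<close>
    define s where "s = exp (- \<bar>M\<bar> - 1)"
    have s: "0 < s" "s < 1" by (simp_all add: s_def)
    have "f ((1 - s) *\<^sub>R u) = Ln (of_real s)"
      by (simp add: f_def scaleR_scaleC l_scale l(3))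
    also have "\<dots> = of_real (- \<bar>M\<bar> - 1)"
      using s by (simp add: Ln_of_real) (simp add: s_def)
    finally have "cmod (f ((1 - s) *\<^sub>R u)) = \<bar>M\<bar> + 1"
      by (simp only: norm_of_real)
    moreover have "(1 - s) *\<^sub>R u \<in> unit_ball" using s u by simp
    ultimately show False using M[of "(1 - s) *\<^sub>R u"] by simp
  qed
  ultimately show ?thesis by blast
qed

theorem proposition3p7:
  assumes infinite_dim: "\<nexists>S :: 'a :: complex_banach set. finite S \<and> cspan S = UNIV"
  shows "(H_infty :: ('a \<Rightarrow> complex) set) \<subset> B_inv"
proof -
  \<comment> \<open>The empty set spans the zero space, so infinite dimension provides a nonzero
    vector.\<close>
  have "\<exists>x :: 'a. x \<noteq> 0"
  proof (rule ccontr)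
    assume "\<not> ?thesis"
    then have "cspan ({} :: 'a set) = UNIV" by auto
    then show False using infinite_dim by blast
  qed
  then show ?thesis using B_inv_not_subset_H_infty H_infty_subset_B_inv by blast
qed

end
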